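(* Let $\mu_0,\mu_1\in\mathcal{P}_0$ and let $(\mu_t)_{t\in[0,1]}$ be the unique geodesic between them in $(\mathcal{P}_0,d^W)$. Then $t\mapsto\mathrm{Ent}(\mu_t\,|\,\mathrm{Leb})$ is a convex function on $[0,1]$ (possibly taking the value $+\infty$). Thus $\mathrm{Ent}(\cdot\,|\,\mathrm{Leb})$ is a.c. displacement $0$-convex on $[0,1]$.
   Context: $\mathrm{Leb}$ is Lebesgue measure on $[0,1]$. $\mathcal{P}_0=\mathcal{P}([0,1])$ is the set of Borel probability measures on $[0,1]$, equipped with the ($2$-)Wasserstein distance $$d^W(\mu,\nu)^2=\inf_{\pi\in\Pi(\mu,\nu)}\int_{[0,1]\times[0,1]}|x-y|^2\,d\pi(x,y),$$ where $\Pi(\mu,\nu)$ is the set of Borel probability measures on $[0,1]\times[0,1]$ with first marginal $\mu$ and second marginal $\nu$. A geodesic between $\mu_0$ and $\mu_1$ is a curve $(\mu_t)_{t\in[0,1]}$ with $d^W(\mu_t,\mu_{t'})=|t-t'|\,d^W(\mu_0,\mu_1)$ for all $t,t'\in[0,1]$; in $(\mathcal{P}_0,d^W)$ geodesics between given endpoints exist and are unique. The entropy is $\mathrm{Ent}(\mu\,|\,\mathrm{Leb})=\int_0^1\rho\log\rho\,dx$ if $\mu\ll\mathrm{Leb}$ with $\mu=\rho\,\mathrm{Leb}$, and $+\infty$ otherwise. "A.c. displacement $0$-convex" means: for all $\mu_0,\mu_1\in\mathcal{P}_0$ with $\mu_0,\mu_1\ll\mathrm{Leb}$, along every geodesic $(\mu_t)$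 between them, $\mathrm{Ent}(\mu_t|\mathrm{Leb})\le t\,\mathrm{Ent}(\mu_1|\mathrm{Leb})+(1-t)\,\mathrm{Ent}(\mu_0|\mathrm{Leb})$ for all $t\in[0,1]$. *)

theory Defs
  imports "HOL-Probability.Probability"
begin

definition borel_probs :: "'a::topological_space set \<Rightarrow> 'a measure set" where
  "borel_probs X = {\<mu>. prob_space \<mu> \<and> sets \<mu> = sets (restrict_space borel X)}"

abbreviation P0 :: "real measure set" where
  "P0 \<equiv> borel_probs {0..1}"

definition Leb :: "real measure" where
  "Leb = restrict_space lborel {0..1}"

definition couplings :: "real measure \<Rightarrow> real measure \<Rightarrow> (real \<times> real) measure set" where
  "couplings \<mu> \<nu> = {\<pi> \<in> borel_probs ({0..1} \<times> {0..1}). distr \<pi> \<mu> fst = \<mu> \<and> distr \<pi> \<nu> snd = \<nu>}"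

(* The integrand is bounded and \<mu> \<Otimes>\<^sub>M \<nu> is a coupling, so for \<mu>, \<nu> in P0 neither the
   Bochner integral nor the real infimum takes a default value. *)
definition dW :: "real measure \<Rightarrow> real measure \<Rightarrow> real" where
  "dW \<mu> \<nu> = sqrt (INF \<pi>\<in>couplings \<mu> \<nu>. \<integral>z. \<bar>fst z - snd z\<bar>\<^sup>2 \<partial>\<pi>)"

(* Curves are total functions; only their values on [0,1] matter. *)
definition geodesic_between ::
    "real measure \<Rightarrow> real measure \<Rightarrow> (real \<Rightarrow> real measure) \<Rightarrow> bool" where
  "geodesic_between \<mu>0 \<mu>1 \<mu> \<longleftrightarrow>
     (\<forall>t\<in>{0..1}. \<mu> t \<in> P0) \<and> \<mu> 0 = \<mu>0 \<and> \<mu> 1 = \<mu>1 \<and>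
     (\<forall>t\<in>{0..1}. \<forall>t'\<in>{0..1}. dW (\<mu> t) (\<mu> t') = \<bar>t - t'\<bar> * dW \<mu>0 \<mu>1)"

(* The extended integral of \<rho> ln \<rho>, as positive part minus negative part (ennreal truncates negative
   reals to 0); it may be \<infinity> even when \<mu> is absolutely continuous. As r ln r \<ge> -1/e, the
   negative part is finite for finite \<nu>. Isabelle's ln 0 = 0 gives 0 ln 0 = 0. *)
definition Ent :: "'a measure \<Rightarrow> 'a measure \<Rightarrow> ereal" where
  "Ent \<mu> \<nu> =
     (if absolutely_continuous \<nu> \<mu> then
        let \<rho> = (\<lambda>x. enn2real (RN_deriv \<nu> \<mu> x)) in
          enn2ereal (\<integral>\<^sup>+x. ennreal (\<rho> x * ln (\<rho> x)) \<partial>\<nu>)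
          - enn2ereal (\<integral>\<^sup>+x. ennreal (- (\<rho> x * ln (\<rho> x))) \<partial>\<nu>)
      else \<infinity>)"

(* The extended-valued version of convex_on. In ereal 0 * \<infinity> = 0, so the condition
   is trivial when u or v is 0. *)
definition ereal_convex_on :: "'a::real_vector set \<Rightarrow> ('a \<Rightarrow> ereal) \<Rightarrow> bool" where
  "ereal_convex_on S f \<longleftrightarrow> convex S \<and>
     (\<forall>x\<in>S. \<forall>y\<in>S. \<forall>u\<ge>0. \<forall>v\<ge>0. u + v = 1 \<longrightarrow>
        f (u *\<^sub>R x + v *\<^sub>R y) \<le> ereal u * f x + ereal v * f y)"

definition ac_displacement_zero_convex :: "(real measure \<Rightarrow> ereal) \<Rightarrow> bool" where
  "ac_displacement_zero_convex E \<longleftrightarrow>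
     (\<forall>\<mu>0\<in>P0. \<forall>\<mu>1\<in>P0. absolutely_continuous Leb \<mu>0 \<longrightarrow> absolutely_continuous Leb \<mu>1 \<longrightarrow>
        (\<forall>\<mu>. geodesic_between \<mu>0 \<mu>1 \<mu> \<longrightarrow>
           (\<forall>t\<in>{0..1}. E (\<mu> t) \<le> ereal t * E \<mu>1 + ereal (1 - t) * E \<mu>0)))"

end

theory Submission
  imports Defs
begin

text \<open>Every measure in \<open>P0\<close> is the law of its quantile function under Lebesgue measure on
  \<open>(0,1)\<close>, and \<open>dW\<close> is the \<open>L\<^sup>2\<close> distance of quantile functions, because the quantile coupling
  maximises the expected product. Strict convexity of the \<open>L\<^sup>2\<close> norm therefore forces a point on a
  geodesic to have quantile function \<open>Z = u * Q + v * R\<close>. Let \<open>\<rho>\<^sub>0, \<rho>\<^sub>1\<close> be the densities of the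
  end points. The function \<open>w = u / \<rho>\<^sub>0(Q) + v / \<rho>\<^sub>1(R)\<close> plays the role of the derivative of \<open>Z\<close>;
  instead of differentiating monotone functions one checks on intervals that the image of \<open>w ds\<close>
  under \<open>Z\<close> is bounded by Lebesgue measure. Hence the law of \<open>Z\<close> has a density \<open>\<rho>\<close>, and
  \<open>\<integral> \<rho>(Z) w ds \<le> 1\<close>. Integrating \<open>ln \<rho>(Z) + ln w \<le> \<rho>(Z) w - 1\<close> and using the concavity of \<open>ln\<close>
  in \<open>- ln w \<le> u ln \<rho>\<^sub>0(Q) + v ln \<rho>\<^sub>1(R)\<close> gives convexity of the entropy.\<close>

section \<open>Domination by Lebesgue measure\<close>

text \<open>The interval bound says exactly that \<open>F x = x - cdf \<nu> x\<close> is
  nondecreasing, so \<open>F\<close> has a Stieltjes measure. Adding it to \<nu> reproduces the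
  length of every half-open interval, hence Lebesgue measure; dropping this nonnegative summand
  gives the bound.\<close>

lemma emeasure_le_lborel:
  fixes \<nu> :: "real measure"
  assumes "finite_borel_measure \<nu>"
    and Ioc: "\<And>a b. a \<le> b \<Longrightarrow> emeasure \<nu> {a<..b} \<le> ennreal (b - a)"
    and A: "A \<in> sets borel"
  shows "emeasure \<nu> A \<le> emeasure lborel A"
proof -
  interpret finite_borel_measure \<nu> by fact
  define F where "F x = x - cdf \<nu> x" for x
  have mono_F: "F x \<le> F y" if "x \<le> y" for x y
    using Ioc[OF that] that cdf_nondecreasing[OF that] by (simp add: emeasure_Ioc F_def)
  have cont_F: "continuous (at_right a) F" for a
    unfolding F_def by (intro continuous_intros cdf_is_right_cont)
  define S where "S = measure_of UNIV (sets borel) (\<lambda>A. emeasure \<nu> A + emeasure (interval_measure F) A)"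
  have sets_S: "sets S = sets borel"
    unfolding S_def by (metis sets.sets_measure_of_eq space_borel)
  have S: "emeasure S B = emeasure \<nu> B + emeasure (interval_measure F) B" if "B \<in> sets borel" for B
    unfolding S_def
  proof (rule emeasure_measure_of_sigma)
    show "countably_additive (sets borel) (\<lambda>A. emeasure \<nu> A + emeasure (interval_measure F) A)"
      unfolding countably_additive_def
      by (auto simp: suminf_add[symmetric] suminf_emeasure M_is_borel)
  qed (use that sets.sigma_algebra_axioms[of "borel :: real measure"] in \<open>auto simp: positive_def\<close>)
  have eq: "emeasure lborel {a<..b} = emeasure S {a<..b}" for a b
  proof (cases "a \<le> b")
    case True
    then show ?thesis
      using cdf_nondecreasing[OF True] mono_F[OF True]
        emeasure_interval_measure_Ioc[of a b F, OF True mono_F cont_F]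
      by (simp add: S emeasure_Ioc flip: ennreal_plus) (simp add: F_def)
  qed simp
  have "lborel = S"
    by (rule measure_eqI_generator_eq[where \<Omega>=UNIV and E="range (\<lambda>(a, b). {a<..b::real})"
          and A="\<lambda>i. {- real i<..real i}"])
       (auto simp: sets_S borel_sigma_sets_Ioc Int_stable_def UN_Ioc_eq_UNIV simp flip: eq)
  then show ?thesis using S[OF A] by simp
qed

section \<open>The product inequality for comonotone variables\<close>

text \<open>A nonnegative number \<open>c\<close> is the length of the set of \<open>a\<close> with
  \<open>0 < a\<close> and \<open>a < c\<close>. Writing both factors in this way and exchanging
  integrals by Tonelli turns the expected product into an integral of joint tails.\<close>

lemma nn_integral_mult_layer_cake:
  assumes "prob_space M" and [measurable]: "X \<in> borel_measurable M" "Y \<in> borel_measurable M"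
    and pos: "\<And>x. x \<in> space M \<Longrightarrow> 0 \<le> X x" "\<And>x. x \<in> space M \<Longrightarrow> 0 \<le> Y x"
  shows "(\<integral>\<^sup>+x. ennreal (X x * Y x) \<partial>M) =
    (\<integral>\<^sup>+a. \<integral>\<^sup>+b. indicator {0<..} a * indicator {0<..} b *
       emeasure M {x \<in> space M. a < X x \<and> b < Y x} \<partial>lborel \<partial>lborel)"
proof -
  interpret prob_space M by fact
  interpret P: pair_sigma_finite M lborel ..
  let ?i = "\<lambda>a c. indicator {(a, c). 0 < a \<and> a < c} (a, c) :: ennreal"
  have i: "(\<integral>\<^sup>+a. ?i a c \<partial>lborel) = ennreal c" if "0 \<le> c" for c :: real
  proof -
    have "(\<integral>\<^sup>+a. ?i a c \<partial>lborel) = (\<integral>\<^sup>+a. indicator {0<..<c} a \<partial>lborel)"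
      by (intro nn_integral_cong) (auto simp: indicator_def)
    then show ?thesis using that by simp
  qed
  have "(\<integral>\<^sup>+x. ennreal (X x * Y x) \<partial>M) =
      (\<integral>\<^sup>+x. \<integral>\<^sup>+a. ?i a (X x) * ennreal (Y x) \<partial>lborel \<partial>M)"
    by (intro nn_integral_cong) (simp add: nn_integral_multc i pos ennreal_mult)
  also have "\<dots> = (\<integral>\<^sup>+a. \<integral>\<^sup>+x. ?i a (X x) * ennreal (Y x) \<partial>M \<partial>lborel)"
    by (intro P.Fubini'[symmetric]) measurable
  also have "\<dots> = (\<integral>\<^sup>+a. \<integral>\<^sup>+x. \<integral>\<^sup>+b. ?i a (X x) * ?i b (Y x) \<partial>lborel \<partial>M \<partial>lborel)"
    by (intro nn_integral_cong) (simp add: nn_integral_cmult i pos)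
  also have "\<dots> = (\<integral>\<^sup>+a. \<integral>\<^sup>+b. \<integral>\<^sup>+x. ?i a (X x) * ?i b (Y x) \<partial>M \<partial>lborel \<partial>lborel)"
    by (intro nn_integral_cong P.Fubini'[symmetric]) measurable
  also have "\<dots> = (\<integral>\<^sup>+a. \<integral>\<^sup>+b. indicator {0<..} a * indicator {0<..} b *
       emeasure M {x \<in> space M. a < X x \<and> b < Y x} \<partial>lborel \<partial>lborel)"
  proof (intro nn_integral_cong)
    fix a b :: real
    have "(\<integral>\<^sup>+x. ?i a (X x) * ?i b (Y x) \<partial>M) =
       (\<integral>\<^sup>+x. (indicator {0<..} a * indicator {0<..} b) *
          indicator {x \<in> space M. a < X x \<and> b < Y x} x \<partial>M)"
      by (intro nn_integral_cong) (auto simp: indicator_def)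
    also have "\<dots> = indicator {0<..} a * indicator {0<..} b *
       emeasure M {x \<in> space M. a < X x \<and> b < Y x}"
      by (subst nn_integral_cmult) auto
    finally show "(\<integral>\<^sup>+x. ?i a (X x) * ?i b (Y x) \<partial>M) = indicator {0<..} a * indicator {0<..} b *
       emeasure M {x \<in> space M. a < X x \<and> b < Y x}" .
  qed
  finally show ?thesis .
qed

text \<open>Hoeffding's argument: comonotone variables attain the Frechet upper bound
  $\min(P(X > a), P(Y > b))$ on the joint tail.\<close>

lemma comonotone_maximizes_product:
  fixes X Y :: "'a \<Rightarrow> real" and f g :: "'b \<Rightarrow> real"
  assumes M: "prob_space M" and U: "prob_space U"
    and [measurable]: "X \<in> borel_measurable M" "Y \<in> borel_measurable M"
      "f \<in> borel_measurable U" "g \<in> borel_measurable U"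
    and pos: "\<And>x. x \<in> space M \<Longrightarrow> 0 \<le> X x" "\<And>x. x \<in> space M \<Longrightarrow> 0 \<le> Y x"
      "\<And>x. x \<in> space U \<Longrightarrow> 0 \<le> f x" "\<And>x. x \<in> space U \<Longrightarrow> 0 \<le> g x"
    and X: "distr M borel X = distr U borel f" and Y: "distr M borel Y = distr U borel g"
    and nested: "\<And>a b. {s \<in> space U. a < f s} \<subseteq> {s \<in> space U. b < g s} \<or>
                        {s \<in> space U. b < g s} \<subseteq> {s \<in> space U. a < f s}"
  shows "(\<integral>\<^sup>+x. ennreal (X x * Y x) \<partial>M) \<le> (\<integral>\<^sup>+s. ennreal (f s * g s) \<partial>U)"
proof -
  have XY: "emeasure M {x \<in> space M. a < X x} = emeasure U {s \<in> space U. a < f s}"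
      "emeasure M {x \<in> space M. a < Y x} = emeasure U {s \<in> space U. a < g s}" for a
    using arg_cong[OF X, of "\<lambda>N. emeasure N {a<..}"] arg_cong[OF Y, of "\<lambda>N. emeasure N {a<..}"]
    by (auto simp: emeasure_distr vimage_def Int_def conj_commute)
  have le: "emeasure M {x \<in> space M. a < X x \<and> b < Y x} \<le> emeasure U {s \<in> space U. a < f s \<and> b < g s}"
    for a b
  proof -
    have "emeasure M {x \<in> space M. a < X x \<and> b < Y x} \<le> emeasure M {x \<in> space M. a < X x}"
         "emeasure M {x \<in> space M. a < X x \<and> b < Y x} \<le> emeasure M {x \<in> space M. b < Y x}"
      by (auto intro!: emeasure_mono)
    \<comment> \<open>By nestedness the joint tail event of \<open>f\<close> and \<open>g\<close> is
      one of their two single tail events, and the probability of each of these bounds the joint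
      tail of \<open>X\<close> and \<open>Y\<close>.\<close>
    moreover have "{s \<in> space U. a < f s \<and> b < g s} = {s \<in> space U. a < f s} \<or>
        {s \<in> space U. a < f s \<and> b < g s} = {s \<in> space U. b < g s}"
      using nested[of a b] by blast
    ultimately show ?thesis using XY by auto
  qed
  show ?thesis
    unfolding nn_integral_mult_layer_cake[OF M \<open>X \<in> _\<close> \<open>Y \<in> _\<close> pos(1,2), simplified]
      nn_integral_mult_layer_cake[OF U \<open>f \<in> _\<close> \<open>g \<in> _\<close> pos(3,4), simplified]
    by (intro nn_integral_mono mult_left_mono le) auto
qed

section \<open>Quantile functions\<close>

abbreviation U01 :: "real measure" where
  "U01 \<equiv> restrict_space lborel {0<..<1}"

definition quantile_of :: "real measure \<Rightarrow> (real \<Rightarrow> real) \<Rightarrow> bool" where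
  "quantile_of \<mu> Q \<longleftrightarrow> mono_on {0<..<1} Q \<and> (\<forall>s\<in>{0<..<1}. Q s \<in> {0..1}) \<and> distr U01 \<mu> Q = \<mu>"

lemma prob_space_U01: "prob_space U01"
  by (auto simp add: emeasure_restrict_space space_restrict_space intro!: prob_spaceI)

lemma space_U01: "space U01 = {0<..<1}"
  by (simp add: space_restrict_space)

lemma P0D:
  assumes "\<mu> \<in> P0"
  shows "prob_space \<mu>" "sets \<mu> = sets (restrict_space borel {0..1})" "space \<mu> = {0..1}"
  using assms sets_eq_imp_space_eq[of \<mu> "restrict_space borel {0..1}"]
  by (auto simp: borel_probs_def space_restrict_space)

lemma measurable_P0:
  assumes "\<mu> \<in> P0"
  shows "f \<in> N \<rightarrow>\<^sub>M \<mu> \<longleftrightarrow> f \<in> borel_measurable N \<and> f \<in> space N \<rightarrow> {0..1}"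
  using measurable_cong_sets[OF refl P0D(2)[OF assms], of N]
  by (auto simp: measurable_restrict_space2_iff)

lemma borel_measurable_id_P0:
  assumes "\<mu> \<in> P0" shows "(\<lambda>x. x) \<in> borel_measurable \<mu>"
  using measurable_P0[OF assms, of "\<lambda>x. x" \<mu>] by simp

lemma quantile_measurable:
  assumes "quantile_of \<mu> Q"
  shows "Q \<in> borel_measurable U01"
proof -
  have "Q \<in> borel_measurable (restrict_space borel {0<..<1})"
    using assms by (intro borel_measurable_mono_on_fnc) (auto simp: quantile_of_def)
  then show ?thesis
    by (subst measurable_cong_sets[OF sets_restrict_space_cong[OF sets_lborel] refl])
qed

lemma quantile_measurable_P0:
  assumes "quantile_of \<mu> Q" "\<mu> \<in> P0"
  shows "Q \<in> U01 \<rightarrow>\<^sub>M \<mu>"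
  using assms quantile_measurable[OF assms(1)]
  by (auto simp: measurable_P0 quantile_of_def space_U01)

text \<open>The generalised inverse of the distribution function works. It is formed for the image
  \<open>M\<close> of \<mu> on the whole line, where the theory of distribution functions applies,
  and the law is then brought back to [0,1].\<close>

lemma quantile_exists:
  assumes \<mu>: "\<mu> \<in> P0"
  obtains Q where "quantile_of \<mu> Q"
proof -
  note [measurable] = borel_measurable_id_P0[OF \<mu>]
  define M where "M = distr \<mu> borel (\<lambda>x. x)"
  interpret prob_space \<mu> by (rule P0D[OF \<mu>])
  interpret M: cdf_distribution M
    unfolding M_def cdf_distribution_def by (rule real_distribution_distr) measurable
  define Q where "Q = (\<lambda>s. Inf {x. s \<le> cdf M x})"
  have mono: "mono_on {0<..<1} Q"
    unfolding Q_def by (rule M.mono_I)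
  have M_eq: "M = distr U01 borel Q"
    unfolding Q_def by (rule M.distr_I_eq_M[symmetric])
  have [measurable]: "Q \<in> borel_measurable U01"
    using borel_measurable_mono_on_fnc[OF mono]
    by (subst measurable_cong_sets[OF sets_restrict_space_cong[OF sets_lborel] refl])
  \<comment> \<open>The equivalence \<open>iff\<close> at 1 gives \<open>Q s \<le> 1\<close>. At
    \<open>Q s\<close> itself it gives \<open>s \<le> cdf M (Q s)\<close>, which for negative
    \<open>Q s\<close> would contradict \<open>0 < s\<close>, because \<open>cdf M\<close> vanishes
    there.\<close>
  have range: "Q s \<in> {0..1}" if s: "s \<in> {0<..<1}" for s
  proof -
    have iff: "s \<le> cdf M x \<longleftrightarrow> Q s \<le> x" for x
      using s unfolding Q_def by (intro M.pseudoinverse) auto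
    have "cdf M 1 = 1"
    proof -
      have "{..1} \<inter> space \<mu> = space \<mu>"
        using P0D(3)[OF \<mu>] by auto
      then show ?thesis
        using prob_space by (simp add: cdf_def M_def measure_distr)
    qed
    moreover have "cdf M x = 0" if "x < 0" for x
      using that P0D(3)[OF \<mu>] by (auto simp: cdf_def M_def measure_distr vimage_def Int_def
        intro!: arg_cong[where f=prob, of _ "{}", simplified] cong: conj_cong)
    ultimately show ?thesis
      using s iff[of 1] iff[of "Q s"] by (cases "Q s < 0") auto
  qed
  have "distr U01 \<mu> Q = \<mu>"
  proof (rule measure_eqI)
    fix A assume "A \<in> sets (distr U01 \<mu> Q)"
    then have A: "A \<in> sets \<mu>" by simp
    then obtain B where B: "B \<in> sets borel" "A = {0..1} \<inter> B"
      unfolding P0D(2)[OF \<mu>] by (auto simp: sets_restrict_space)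
    then have Ab: "A \<in> sets borel" by auto
    have "Q \<in> U01 \<rightarrow>\<^sub>M \<mu>"
      using range by (auto simp: measurable_P0[OF \<mu>] space_U01)
    then have "emeasure (distr U01 \<mu> Q) A = emeasure (distr U01 borel Q) A"
      using A Ab by (simp add: emeasure_distr)
    also have "\<dots> = emeasure \<mu> A"
      unfolding M_eq[symmetric] M_def using Ab B P0D(3)[OF \<mu>]
      by (subst emeasure_distr) (auto intro!: arg_cong[where f="emeasure \<mu>"])
    finally show "emeasure (distr U01 \<mu> Q) A = emeasure \<mu> A" .
  qed simp
  then show thesis
    using mono range by (intro that[of Q]) (auto simp: quantile_of_def)
qed

text \<open>This moves equality of laws from the space of \<mu> to the whole line, the form in which
  \<open>comonotone_maximizes_product\<close> takes it.\<close>

lemma quantile_distr_borel: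
  assumes Q: "quantile_of \<mu> Q" and \<mu>: "\<mu> \<in> P0"
    and X: "X \<in> M \<rightarrow>\<^sub>M \<mu>" "distr M \<mu> X = \<mu>"
  shows "distr M borel X = distr U01 borel Q"
proof -
  note i = borel_measurable_id_P0[OF \<mu>]
  have "distr M borel X = distr (distr M \<mu> X) borel (\<lambda>x. x)"
    by (subst distr_distr[OF i X(1)]) (simp add: comp_def)
  also have "\<dots> = distr (distr U01 \<mu> Q) borel (\<lambda>x. x)"
    using Q X by (simp add: quantile_of_def)
  also have "\<dots> = distr U01 borel Q"
    by (subst distr_distr[OF i quantile_measurable_P0[OF Q \<mu>]]) (simp add: comp_def)
  finally show ?thesis .
qed

text \<open>Superlevel sets of monotone functions are upper sets of a linear order, and two upper
  sets are always comparable.\<close>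

lemma mono_nested:
  fixes f g :: "real \<Rightarrow> real"
  assumes "mono_on S f" "mono_on S g"
  shows "{s \<in> S. a < f s} \<subseteq> {s \<in> S. b < g s} \<or> {s \<in> S. b < g s} \<subseteq> {s \<in> S. a < f s}"
proof (rule ccontr)
  assume "\<not> ?thesis"
  then obtain s t where "s \<in> S" "t \<in> S" "a < f s" "\<not> b < g s" "b < g t" "\<not> a < f t" by auto
  then show False
    using assms[THEN mono_onD, of s t] assms[THEN mono_onD, of t s]
    by (cases "s \<le> t") auto
qed

section \<open>Optimal couplings and the Wasserstein distance\<close>

lemma coupling_coords:
  assumes \<pi>: "\<pi> \<in> couplings \<mu> \<nu>" and "\<mu> \<in> P0" "\<nu> \<in> P0"
  shows "fst \<in> \<pi> \<rightarrow>\<^sub>M \<mu>" "snd \<in> \<pi> \<rightarrow>\<^sub>M \<nu>" "space \<pi> = {0..1} \<times> {0..1}" "prob_space \<pi>"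
    "distr \<pi> \<mu> fst = \<mu>" "distr \<pi> \<nu> snd = \<nu>"
proof -
  have s: "sets \<pi> = sets (restrict_space borel ({0..1} \<times> {0..1}))" and "prob_space \<pi>"
    "distr \<pi> \<mu> fst = \<mu>" "distr \<pi> \<nu> snd = \<nu>"
    using \<pi> by (auto simp: couplings_def borel_probs_def)
  moreover show sp: "space \<pi> = {0..1} \<times> {0..1}"
    using sets_eq_imp_space_eq[OF s] by (simp add: space_restrict_space)
  moreover have "fst \<in> borel_measurable \<pi>" "snd \<in> borel_measurable \<pi>"
    by (simp_all add: measurable_cong_sets[OF s refl] measurable_restrict_space1
      borel_measurable_continuous_onI continuous_on_fst continuous_on_snd)
  ultimately show "fst \<in> \<pi> \<rightarrow>\<^sub>M \<mu>" "snd \<in> \<pi> \<rightarrow>\<^sub>M \<nu>" "prob_space \<pi>"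
    "distr \<pi> \<mu> fst = \<mu>" "distr \<pi> \<nu> snd = \<nu>"
    using assms by (auto simp: measurable_P0)
qed

text \<open>When the square is expanded, the second moments depend on the marginals only. Lower cost
  therefore means a larger expected product, and \<open>Q\<close>, \<open>R\<close> are
  comonotone.\<close>

lemma quantile_coupling_optimal:
  assumes \<mu>: "\<mu> \<in> P0" and \<nu>: "\<nu> \<in> P0" and Q: "quantile_of \<mu> Q" and R: "quantile_of \<nu> R"
    and \<pi>: "\<pi> \<in> couplings \<mu> \<nu>"
  shows "(\<integral>s. \<bar>Q s - R s\<bar>\<^sup>2 \<partial>U01) \<le> (\<integral>z. \<bar>fst z - snd z\<bar>\<^sup>2 \<partial>\<pi>)"
proof -
  note c = coupling_coords[OF \<pi> \<mu> \<nu>]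
  interpret \<pi>: prob_space \<pi> by (rule c)
  interpret U: prob_space U01 by (rule prob_space_U01)
  have [measurable]: "fst \<in> borel_measurable \<pi>" "snd \<in> borel_measurable \<pi>"
    using c(1,2) by (auto simp: measurable_P0 \<mu> \<nu>)
  note [measurable] = quantile_measurable[OF Q] quantile_measurable[OF R]
  have bQ: "0 \<le> Q s" "Q s \<le> 1" "0 \<le> R s" "R s \<le> 1" if "s \<in> space U01" for s
    using that Q R by (auto simp: quantile_of_def space_U01)
  have bp: "0 \<le> fst z" "fst z \<le> 1" "0 \<le> snd z" "snd z \<le> 1" if "z \<in> space \<pi>" for z
    using that by (auto simp: c)
  have d: "distr \<pi> borel fst = distr U01 borel Q" "distr \<pi> borel snd = distr U01 borel R"
    by (rule quantile_distr_borel[OF Q \<mu> c(1,5)], rule quantile_distr_borel[OF R \<nu> c(2,6)])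
  have b: "\<bar>x * y\<bar> \<le> 1" if "0 \<le> x" "x \<le> 1" "0 \<le> y" "y \<le> 1" for x y :: real
    using that by (simp add: mult_le_one)
  have i\<pi>: "integrable \<pi> (\<lambda>z. fst z * fst z)" "integrable \<pi> (\<lambda>z. snd z * snd z)"
      "integrable \<pi> (\<lambda>z. fst z * snd z)"
    by (rule \<pi>.integrable_const_bound[of _ 1], rule AE_I2, unfold real_norm_def,
        intro b bp, assumption+, measurable)+
  have iU: "integrable U01 (\<lambda>s. Q s * Q s)" "integrable U01 (\<lambda>s. R s * R s)"
      "integrable U01 (\<lambda>s. Q s * R s)"
    by (rule U.integrable_const_bound[of _ 1], rule AE_I2, unfold real_norm_def,
        intro b bQ, assumption+, measurable)+
  have sq: "(\<integral>z. fst z * fst z \<partial>\<pi>) = (\<integral>s. Q s * Q s \<partial>U01)"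
      "(\<integral>z. snd z * snd z \<partial>\<pi>) = (\<integral>s. R s * R s \<partial>U01)"
    using arg_cong[OF d(1), of "\<lambda>N. \<integral>x. x * x \<partial>N"] arg_cong[OF d(2), of "\<lambda>N. \<integral>x. x * x \<partial>N"]
    by (simp_all add: integral_distr)
  have "ennreal (\<integral>z. fst z * snd z \<partial>\<pi>) \<le> ennreal (\<integral>s. Q s * R s \<partial>U01)"
  proof (subst (1 2) nn_integral_eq_integral[symmetric])
    show "(\<integral>\<^sup>+z. ennreal (fst z * snd z) \<partial>\<pi>) \<le> (\<integral>\<^sup>+s. ennreal (Q s * R s) \<partial>U01)"
    proof (rule comonotone_maximizes_product)
      show "{s \<in> space U01. a < Q s} \<subseteq> {s \<in> space U01. b < R s} \<or>
        {s \<in> space U01. b < R s} \<subseteq> {s \<in> space U01. a < Q s}" for a b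
        unfolding space_U01 using Q R by (intro mono_nested) (auto simp: quantile_of_def)
    qed (use d bp bQ in \<open>auto intro: \<pi>.prob_space_axioms U.prob_space_axioms\<close>)
  qed (use i\<pi> iU bp bQ in auto)
  moreover have "0 \<le> (\<integral>s. Q s * R s \<partial>U01)"
    by (intro integral_nonneg_AE AE_I2) (auto simp: bQ)
  ultimately have "(\<integral>z. fst z * snd z \<partial>\<pi>) \<le> (\<integral>s. Q s * R s \<partial>U01)"
    by simp
  moreover have "(\<integral>z. \<bar>fst z - snd z\<bar>\<^sup>2 \<partial>\<pi>) =
      (\<integral>z. fst z * fst z \<partial>\<pi>) + (\<integral>z. snd z * snd z \<partial>\<pi>) - 2 * (\<integral>z. fst z * snd z \<partial>\<pi>)"
  proof -
    have "(\<integral>z. \<bar>fst z - snd z\<bar>\<^sup>2 \<partial>\<pi>) =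
        (\<integral>z. (fst z * fst z + snd z * snd z) - 2 * (fst z * snd z) \<partial>\<pi>)"
      by (intro Bochner_Integration.integral_cong) (auto simp: power2_eq_square algebra_simps)
    then show ?thesis using i\<pi> by simp
  qed
  moreover have "(\<integral>s. \<bar>Q s - R s\<bar>\<^sup>2 \<partial>U01) =
      (\<integral>s. Q s * Q s \<partial>U01) + (\<integral>s. R s * R s \<partial>U01) - 2 * (\<integral>s. Q s * R s \<partial>U01)"
  proof -
    have "(\<integral>s. \<bar>Q s - R s\<bar>\<^sup>2 \<partial>U01) =
        (\<integral>s. (Q s * Q s + R s * R s) - 2 * (Q s * R s) \<partial>U01)"
      by (intro Bochner_Integration.integral_cong) (auto simp: power2_eq_square algebra_simps)
    then show ?thesis using iU by simp
  qed
  ultimately show ?thesis using sq by simp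
qed

text \<open>Driving both quantile functions by the same uniform variable gives a coupling that
  attains the lower bound of \<open>quantile_coupling_optimal\<close>.\<close>

lemma quantile_coupling:
  assumes \<mu>: "\<mu> \<in> P0" and \<nu>: "\<nu> \<in> P0" and Q: "quantile_of \<mu> Q" and R: "quantile_of \<nu> R"
  obtains \<pi> where "\<pi> \<in> couplings \<mu> \<nu>"
    "(\<integral>z. \<bar>fst z - snd z\<bar>\<^sup>2 \<partial>\<pi>) = (\<integral>s. \<bar>Q s - R s\<bar>\<^sup>2 \<partial>U01)"
proof
  interpret U: prob_space U01 by (rule prob_space_U01)
  note [measurable] = quantile_measurable[OF Q] quantile_measurable[OF R]
  let ?S = "restrict_space borel ({0..1} \<times> {0..1}) :: (real \<times> real) measure"
  let ?\<pi> = "distr U01 ?S (\<lambda>s. (Q s, R s))"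
  have m: "(\<lambda>s. (Q s, R s)) \<in> U01 \<rightarrow>\<^sub>M ?S"
    using Q R by (auto simp: quantile_of_def space_U01 intro!: measurable_restrict_space2)
  have mS: "fst \<in> borel_measurable ?S" "snd \<in> borel_measurable ?S"
    by (simp_all add: measurable_restrict_space1
      borel_measurable_continuous_onI continuous_on_fst continuous_on_snd)
  then have mS': "fst \<in> ?S \<rightarrow>\<^sub>M \<mu>" "snd \<in> ?S \<rightarrow>\<^sub>M \<nu>"
    using \<mu> \<nu> by (auto simp: measurable_P0 space_restrict_space)
  show "?\<pi> \<in> couplings \<mu> \<nu>"
    unfolding couplings_def borel_probs_def
    using Q R U.prob_space_distr[OF m] distr_distr[OF mS'(1) m] distr_distr[OF mS'(2) m]
    by (simp add: comp_def quantile_of_def)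
  note [measurable] = mS
  show "(\<integral>z. \<bar>fst z - snd z\<bar>\<^sup>2 \<partial>?\<pi>) = (\<integral>s. \<bar>Q s - R s\<bar>\<^sup>2 \<partial>U01)"
    by (subst integral_distr[OF m]) auto
qed

lemma dW_quantile:
  assumes "\<mu> \<in> P0" "\<nu> \<in> P0" "quantile_of \<mu> Q" "quantile_of \<nu> R"
  shows "dW \<mu> \<nu> = sqrt (\<integral>s. \<bar>Q s - R s\<bar>\<^sup>2 \<partial>U01)"
proof -
  obtain \<pi> where "\<pi> \<in> couplings \<mu> \<nu>"
    "(\<integral>z. \<bar>fst z - snd z\<bar>\<^sup>2 \<partial>\<pi>) = (\<integral>s. \<bar>Q s - R s\<bar>\<^sup>2 \<partial>U01)"
    using quantile_coupling[OF assms] .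
  then show ?thesis
    unfolding dW_def using quantile_coupling_optimal[OF assms]
    by (intro arg_cong[where f=sqrt] cInf_eq_minimum) force+
qed

section \<open>Quantile functions of points on a geodesic\<close>

lemma bounded_integrable_U01:
  fixes f :: "real \<Rightarrow> real"
  assumes "f \<in> borel_measurable U01" "\<And>s. s \<in> {0<..<1} \<Longrightarrow> \<bar>f s\<bar> \<le> B"
  shows "integrable U01 f"
proof -
  interpret prob_space U01 by (rule prob_space_U01)
  show ?thesis
    using assms by (intro integrable_const_bound[of _ B] AE_I2) (auto simp: space_U01)
qed

text \<open>Stewart's identity expresses the squared deviation of \<open>T\<close> from
  \<open>u * Q + v * R\<close> by the three squared distances. Integrated with the distances
  \<open>v * D\<close>, \<open>u * D\<close> and \<open>D\<close> it gives a multiple of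
  \<open>u + v - 1\<close>, which is zero.\<close>

lemma geodesic_point_quantile:
  assumes P0: "\<mu> \<in> P0" "\<nu> \<in> P0" "\<sigma> \<in> P0"
    and q: "quantile_of \<mu> Q" "quantile_of \<nu> R" "quantile_of \<sigma> T"
    and uv: "0 \<le> u" "0 \<le> v" "u + v = 1"
    and d: "dW \<mu> \<sigma> = v * dW \<mu> \<nu>" "dW \<sigma> \<nu> = u * dW \<mu> \<nu>"
  shows "AE s in U01. T s = u * Q s + v * R s"
proof -
  note [measurable] = q[THEN quantile_measurable]
  let ?n = "\<lambda>f g :: real \<Rightarrow> real. \<integral>s. \<bar>f s - g s\<bar>\<^sup>2 \<partial>U01"
  define D where "D = dW \<mu> \<nu>"
  have n: "?n f g = c\<^sup>2" if "sqrt (?n f g) = c" for f g c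
    using that real_sqrt_pow2[of "?n f g"] by simp
  have D: "?n Q T = (v * D)\<^sup>2" "?n T R = (u * D)\<^sup>2" "?n Q R = D\<^sup>2"
    using d dW_quantile P0 q by (intro n; simp add: D_def)+
  have b: "Q s \<in> {0..1}" "R s \<in> {0..1}" "T s \<in> {0..1}" if "s \<in> {0<..<1}" for s
    using that q by (auto simp: quantile_of_def)
  have b2: "\<bar>\<bar>x - y\<bar>\<^sup>2\<bar> \<le> 1" if "x \<in> {0..1}" "y \<in> {0..1}" for x y :: real
    using that by (auto simp: abs_square_le_1)
  have i: "integrable U01 (\<lambda>s. \<bar>Q s - T s\<bar>\<^sup>2)" "integrable U01 (\<lambda>s. \<bar>T s - R s\<bar>\<^sup>2)"
      "integrable U01 (\<lambda>s. \<bar>Q s - R s\<bar>\<^sup>2)"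
    by (rule bounded_integrable_U01[of _ 1], measurable, intro b2 b, assumption+)+
  have stewart: "(T s - (u * Q s + v * R s))\<^sup>2 =
      u * \<bar>Q s - T s\<bar>\<^sup>2 + v * \<bar>T s - R s\<bar>\<^sup>2 - u * v * \<bar>Q s - R s\<bar>\<^sup>2" for s
  proof -
    have v: "v = 1 - u" using uv by simp
    show ?thesis unfolding v by (simp add: power2_eq_square algebra_simps)
  qed
  have "(\<integral>s. (T s - (u * Q s + v * R s))\<^sup>2 \<partial>U01) = u * ?n Q T + v * ?n T R - u * v * ?n Q R"
    unfolding stewart using i by simp
  also have "\<dots> = u * v * D\<^sup>2 * (u + v - 1)"
    unfolding D by (simp add: power2_eq_square algebra_simps)
  finally have "(\<integral>s. (T s - (u * Q s + v * R s))\<^sup>2 \<partial>U01) = 0"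
    using uv by simp
  moreover have "integrable U01 (\<lambda>s. (T s - (u * Q s + v * R s))\<^sup>2)"
    unfolding stewart using i by simp
  ultimately show ?thesis
    by (subst (asm) integral_nonneg_eq_0_iff_AE) auto
qed

section \<open>Change of variables along the interpolated quantile function\<close>

lemma nn_integral_Leb:
  assumes "f \<in> borel_measurable Leb"
  shows "(\<integral>\<^sup>+x. f x \<partial>Leb) = (\<integral>\<^sup>+x. f x * indicator {0..1} x \<partial>lborel)"
  unfolding Leb_def by (simp add: nn_integral_restrict_space)

lemma sets_Leb: "\<mu> \<in> P0 \<Longrightarrow> sets \<mu> = sets Leb"
  unfolding Leb_def by (simp add: P0D(2) sets_restrict_space_cong[OF sets_lborel])

text \<open>Since \<open>Q\<close> has law \<open>density Leb r\<close>, the left side is the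
  integral of \<open>r x * inverse (r x)\<close> over the part of the interval in [0,1]. Only an
  inequality holds, because \<open>r\<close> may vanish and the interval may leave [0,1].\<close>

lemma nn_integral_inverse_density_quantile:
  assumes \<mu>: "\<mu> \<in> P0" and Q: "quantile_of \<mu> Q"
    and r[measurable]: "r \<in> borel_measurable Leb" and dens: "density Leb r = \<mu>" and "a \<le> b"
  shows "(\<integral>\<^sup>+s. indicator {a..b} (Q s) * inverse (r (Q s)) \<partial>U01) \<le> ennreal (b - a)"
proof -
  have [measurable]: "indicator {a..b} \<in> borel_measurable Leb"
    unfolding Leb_def by (intro measurable_restrict_space1) simp
  have "r \<in> borel_measurable \<mu>" "indicator {a..b} \<in> borel_measurable \<mu>"
    by (simp_all add: measurable_cong_sets[OF sets_Leb[OF \<mu>] refl] r)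
  note [measurable] = this quantile_measurable_P0[OF Q \<mu>]
  have "(\<integral>\<^sup>+s. indicator {a..b} (Q s) * inverse (r (Q s)) \<partial>U01) =
      (\<integral>\<^sup>+x. indicator {a..b} x * inverse (r x) \<partial>distr U01 \<mu> Q)"
    by (subst nn_integral_distr) auto
  also have "\<dots> = (\<integral>\<^sup>+x. indicator {a..b} x * inverse (r x) \<partial>density Leb r)"
    using Q dens by (simp add: quantile_of_def)
  also have "\<dots> = (\<integral>\<^sup>+x. r x * (indicator {a..b} x * inverse (r x)) \<partial>Leb)"
    by (subst nn_integral_density) auto
  also have "\<dots> \<le> (\<integral>\<^sup>+x. indicator {a..b} x \<partial>Leb)"
  proof (intro nn_integral_mono)
    fix x
    \<comment> \<open>At 0 and at \<open>top\<close> the product is \<open>0 * top\<close>, which is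
      0 in \<open>ennreal\<close>; elsewhere it is 1.\<close>
    have "y * inverse y \<le> 1" for y :: ennreal
      by (cases "y = 0 \<or> y = top") (auto simp: ennreal_mult_divide_eq divide_ennreal_def[symmetric]
        less_top)
    then show "r x * (indicator {a..b} x * inverse (r x)) \<le> indicator {a..b} x"
      by (simp add: indicator_def)
  qed
  also have "\<dots> \<le> (\<integral>\<^sup>+x. indicator {a..b} x \<partial>lborel)"
    by (subst nn_integral_Leb, simp, intro nn_integral_mono) (simp add: indicator_def)
  also have "\<dots> = ennreal (b - a)"
    using \<open>a \<le> b\<close> by simp
  finally show ?thesis .
qed

text \<open>The function integrated below is the derivative of \<open>u * Q + v * R\<close> up to the singular part.\<close>

lemma nn_integral_slope_Ioc:
  assumes \<mu>: "\<mu> \<in> P0" and Q: "quantile_of \<mu> Q"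
    and r[measurable]: "r \<in> borel_measurable Leb" and r': "density Leb r = \<mu>"
    and \<nu>: "\<nu> \<in> P0" and R: "quantile_of \<nu> R"
    and p[measurable]: "p \<in> borel_measurable Leb" and p': "density Leb p = \<nu>"
    and uv: "0 < u" "0 < v" and "a \<le> b"
  shows "(\<integral>\<^sup>+s. indicator {a<..b} (u * Q s + v * R s) *
      (ennreal u * inverse (r (Q s)) + ennreal v * inverse (p (R s))) \<partial>U01) \<le> ennreal (b - a)"
proof -
  define S where "S = {s \<in> {0<..<1}. u * Q s + v * R s \<in> {a<..b}}"
  show ?thesis
  \<comment> \<open>The empty case is split off because infima and suprema over \<open>S\<close> are
    taken in the other one.\<close>
  proof (cases "S = {}")
    case True
    then have "(\<integral>\<^sup>+s. indicator {a<..b} (u * Q s + v * R s) *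
      (ennreal u * inverse (r (Q s)) + ennreal v * inverse (p (R s))) \<partial>U01) = (\<integral>\<^sup>+s. 0 \<partial>U01)"
      by (intro nn_integral_cong) (auto simp: S_def space_U01 indicator_def)
    then show ?thesis by simp
  next
    case False
    have mono: "mono_on {0<..<1} Q" "mono_on {0<..<1} R"
      and rng: "Q s \<in> {0..1}" "R s \<in> {0..1}" if "s \<in> {0<..<1}" for s
      using Q R that by (auto simp: quantile_of_def)
    have S01: "S \<subseteq> {0<..<1}" by (auto simp: S_def)
    define q where "q = Inf (Q ` S)"
    define q' where "q' = Sup (Q ` S)"
    define t where "t = Inf (R ` S)"
    define t' where "t' = Sup (R ` S)"
    have bdd: "bdd_below (Q ` S)" "bdd_above (Q ` S)" "bdd_below (R ` S)" "bdd_above (R ` S)"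
      using rng S01 by (auto intro!: bdd_belowI[of _ 0] bdd_aboveI[of _ 1])
    have Qq: "q \<le> Q s" "Q s \<le> q'" "t \<le> R s" "R s \<le> t'" if "s \<in> S" for s
      using that bdd by (auto simp: q_def q'_def t_def t'_def intro: cINF_lower cSUP_upper)
    \<comment> \<open>Four independent parameters are allowed so that the extrema of
      \<open>Q\<close> and \<open>R\<close> over \<open>S\<close> can be taken separately.
      Monotonicity reduces the claim to the largest and the smallest of them, where the combined
      values lie within \<open>b - a\<close> of each other.\<close>
    have spread: "u * Q s1 + v * R s2 \<le> b - a + u * Q s3 + v * R s4"
      if "s1 \<in> S" "s2 \<in> S" "s3 \<in> S" "s4 \<in> S" for s1 s2 s3 s4
    proof -
      let ?M = "max s1 s2" and ?m = "min s3 s4"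
      have "?M \<in> S" "?m \<in> S" using that by (auto simp: max_def min_def)
      then have "u * Q ?M + v * R ?M \<le> b" "a < u * Q ?m + v * R ?m" by (auto simp: S_def)
      moreover have "Q s1 \<le> Q ?M" "R s2 \<le> R ?M" "Q ?m \<le> Q s3" "R ?m \<le> R s4"
        using mono[THEN mono_onD] S01 that \<open>?M \<in> S\<close> \<open>?m \<in> S\<close>
        by (meson max.cobounded1 max.cobounded2 min.cobounded1 min.cobounded2 subsetD)+
      then have "u * Q s1 \<le> u * Q ?M" "v * R s2 \<le> v * R ?M" "u * Q ?m \<le> u * Q s3"
          "v * R ?m \<le> v * R s4"
        using uv by (simp_all add: mult_left_mono)
      ultimately show ?thesis by linarith
    qed
    \<comment> \<open>The extrema are inserted one at a time: suprema over \<open>s1\<close> and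
      \<open>s2\<close>, then infima over \<open>s3\<close> and \<open>s4\<close>.\<close>
    have "u * q' + v * t' \<le> b - a + u * q + v * t"
    proof -
      have "q' \<le> (b - a + u * Q s3 + v * R s4 - v * R s2) / u"
        if "s2 \<in> S" "s3 \<in> S" "s4 \<in> S" for s2 s3 s4
        unfolding q'_def using False spread that uv
        by (intro cSUP_least) (auto simp: field_simps add_increasing)
      then have "t' \<le> (b - a + u * Q s3 + v * R s4 - u * q') / v"
        if "s3 \<in> S" "s4 \<in> S" for s3 s4
        unfolding t'_def using False that uv
        by (intro cSUP_least) (auto simp: field_simps)
      then have "(u * q' + v * t' - (b - a) - v * R s4) / u \<le> q" if "s4 \<in> S" for s4
        unfolding q_def using False that uv
        by (intro cINF_greatest) (auto simp: field_simps)
      then have "(u * q' + v * t' - (b - a) - u * q) / v \<le> t"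
        unfolding t_def using False uv
        by (intro cINF_greatest) (auto simp: field_simps)
      then show ?thesis using uv by (simp add: field_simps)
    qed
    moreover have le: "q \<le> q'" "t \<le> t'"
      using False Qq by (meson ex_in_conv order_trans)+
    ultimately have "u * (q' - q) + v * (t' - t) \<le> b - a"
      by (simp add: algebra_simps)
    then have *: "ennreal u * ennreal (q' - q) + ennreal v * ennreal (t' - t) \<le> ennreal (b - a)"
      using uv le by (simp add: less_imp_le ennreal_leI flip: ennreal_mult ennreal_plus)
    have "r \<in> borel_measurable \<mu>" "p \<in> borel_measurable \<nu>"
      by (simp_all add: measurable_cong_sets[OF sets_Leb[OF \<mu>] refl]
        measurable_cong_sets[OF sets_Leb[OF \<nu>] refl] r p)
    note [measurable] = this quantile_measurable_P0[OF Q \<mu>] quantile_measurable_P0[OF R \<nu>]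
      quantile_measurable[OF Q] quantile_measurable[OF R]
    have "(\<integral>\<^sup>+s. indicator {a<..b} (u * Q s + v * R s) *
        (ennreal u * inverse (r (Q s)) + ennreal v * inverse (p (R s))) \<partial>U01) \<le>
      (\<integral>\<^sup>+s. ennreal u * (indicator {q..q'} (Q s) * inverse (r (Q s))) +
        ennreal v * (indicator {t..t'} (R s) * inverse (p (R s))) \<partial>U01)"
    proof (intro nn_integral_mono)
      fix s assume "s \<in> space U01"
      then show "indicator {a<..b} (u * Q s + v * R s) *
          (ennreal u * inverse (r (Q s)) + ennreal v * inverse (p (R s))) \<le>
          ennreal u * (indicator {q..q'} (Q s) * inverse (r (Q s))) +
          ennreal v * (indicator {t..t'} (R s) * inverse (p (R s)))"
        using Qq[of s] by (cases "s \<in> S") (auto simp: S_def space_U01)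
    qed
    also have "\<dots> = ennreal u * (\<integral>\<^sup>+s. indicator {q..q'} (Q s) * inverse (r (Q s)) \<partial>U01) +
        ennreal v * (\<integral>\<^sup>+s. indicator {t..t'} (R s) * inverse (p (R s)) \<partial>U01)"
      by (simp add: nn_integral_add nn_integral_cmult)
    also have "\<dots> \<le> ennreal u * ennreal (q' - q) + ennreal v * ennreal (t' - t)"
      by (intro add_mono mult_left_mono nn_integral_inverse_density_quantile[OF \<mu> Q r r']
          nn_integral_inverse_density_quantile[OF \<nu> R p p'] le) auto
    also note *
    finally show ?thesis .
  qed
qed

text \<open>The image \<open>N\<close> of the measure \<open>w ds\<close> under \<open>Z\<close>
  gives each half-open interval at most its length, so \<open>N\<close> lies below Lebesgue measure
  by \<open>emeasure_le_lborel\<close>. Integrating \<open>g\<close> against both measures gives the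
  claim.\<close>

lemma nn_integral_slope_le:
  assumes \<mu>: "\<mu> \<in> P0" and Q: "quantile_of \<mu> Q"
    and r[measurable]: "r \<in> borel_measurable Leb" and r': "density Leb r = \<mu>"
    and \<nu>: "\<nu> \<in> P0" and R: "quantile_of \<nu> R"
    and p[measurable]: "p \<in> borel_measurable Leb" and p': "density Leb p = \<nu>"
    and uv: "0 < u" "0 < v" "u + v = 1"
    and g: "g \<in> borel_measurable Leb"
  shows "(\<integral>\<^sup>+s. g (u * Q s + v * R s) *
      (ennreal u * inverse (r (Q s)) + ennreal v * inverse (p (R s))) \<partial>U01) \<le> (\<integral>\<^sup>+x. g x \<partial>Leb)"
proof -
  have "r \<in> borel_measurable \<mu>" "p \<in> borel_measurable \<nu>"
    by (simp_all add: measurable_cong_sets[OF sets_Leb[OF \<mu>] refl]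
      measurable_cong_sets[OF sets_Leb[OF \<nu>] refl] r p)
  note [measurable] = this quantile_measurable_P0[OF Q \<mu>] quantile_measurable_P0[OF R \<nu>]
    quantile_measurable[OF Q] quantile_measurable[OF R]
  define w where "w s = ennreal u * inverse (r (Q s)) + ennreal v * inverse (p (R s))" for s
  define Z where "Z s = u * Q s + v * R s" for s
  have [measurable]: "w \<in> borel_measurable U01" "Z \<in> borel_measurable U01"
    unfolding w_def Z_def by measurable
  have Z01: "Z s \<in> {0..1}" if "s \<in> {0<..<1}" for s
    using that Q R uv convex_bound_le[of "Q s" 1 "R s" u v] by (auto simp: quantile_of_def Z_def)
  define N where "N = distr (density U01 w) borel Z"
  have N: "emeasure N A = (\<integral>\<^sup>+s. indicator A (Z s) * w s \<partial>U01)" if "A \<in> sets borel" for A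
  proof -
    have "emeasure N A = (\<integral>\<^sup>+x. indicator A x \<partial>N)" using that by (simp add: N_def)
    also have "\<dots> = (\<integral>\<^sup>+s. w s * indicator A (Z s) \<partial>U01)"
      unfolding N_def using that by (subst nn_integral_distr) (auto simp: nn_integral_density)
    finally show ?thesis by (simp add: mult.commute)
  qed
  have Ioc: "emeasure N {a<..b} \<le> ennreal (b - a)" if "a \<le> b" for a b
    unfolding N[of "{a<..b}", simplified] w_def Z_def
    by (rule nn_integral_slope_Ioc[OF \<mu> Q r r' \<nu> R p p' uv(1,2) that])
  \<comment> \<open>This yields finiteness of \<open>N\<close>. The interval starts at -1 because,
    being open on the left, it has to contain the possible value 0 of \<open>Z\<close>.\<close>
  have "emeasure N UNIV = emeasure N {-1<..1}"
    unfolding N[of UNIV, simplified] N[of "{-1<..1}", simplified]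
  proof (intro nn_integral_cong)
    fix s assume "s \<in> space U01"
    then have "Z s \<in> {-1<..1}" using Z01[of s] by (auto simp: space_U01)
    then show "w s = indicator {-1<..1} (Z s) * w s" by simp
  qed
  with Ioc[of "-1" 1] have "emeasure N UNIV \<noteq> \<infinity>"
    by (auto simp: top_unique)
  moreover have "sets N = sets borel" "space N = UNIV" by (simp_all add: N_def)
  ultimately interpret N: finite_borel_measure N
    by (simp add: finite_borel_measure_def finite_borel_measure_axioms_def finite_measureI)
  have le: "N \<le> lborel"
  proof (subst le_measure)
    show "\<forall>A\<in>sets N. emeasure N A \<le> emeasure lborel A"
      using emeasure_le_lborel[OF N.finite_borel_measure_axioms Ioc] by (simp add: N.M_is_borel)
  qed (simp add: N.M_is_borel)
  \<comment> \<open>Since \<open>g\<close> is measurable only on [0,1], it is extended by zero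
    before integration on the whole line.\<close>
  define g' where "g' x = g x * indicator {0..1} x" for x
  have [measurable]: "g' \<in> borel_measurable borel"
    using g unfolding g'_def Leb_def by (subst (asm) borel_measurable_restrict_space_iff_ennreal) auto
  have "(\<integral>\<^sup>+s. g (Z s) * w s \<partial>U01) = (\<integral>\<^sup>+s. w s * g' (Z s) \<partial>U01)"
    using Z01 by (intro nn_integral_cong) (auto simp: g'_def space_U01 mult.commute)
  also have "\<dots> = (\<integral>\<^sup>+x. g' x \<partial>N)"
    unfolding N_def by (simp add: nn_integral_distr nn_integral_density)
  also have "\<dots> \<le> (\<integral>\<^sup>+x. g' x \<partial>lborel)"
    by (intro nn_integral_mono_measure le) (simp add: N.M_is_borel)
  also have "\<dots> = (\<integral>\<^sup>+x. g x \<partial>Leb)"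
    by (simp add: nn_integral_Leb[OF g] g'_def)
  finally show ?thesis unfolding Z_def w_def .
qed

section \<open>Entropy in quantile coordinates\<close>

lemma prob_space_Leb: "prob_space Leb"
  by (auto simp add: Leb_def emeasure_restrict_space space_restrict_space intro!: prob_spaceI)

lemma density_RN_deriv_Leb:
  assumes "\<mu> \<in> P0" "absolutely_continuous Leb \<mu>"
  shows "density Leb (RN_deriv Leb \<mu>) = \<mu>"
proof -
  interpret prob_space Leb by (rule prob_space_Leb)
  show ?thesis using assms by (intro density_RN_deriv) (auto simp: sets_Leb)
qed

text \<open>A density is nonzero almost everywhere for the measure that it defines, and it is finite
  because \<mu> is sigma-finite. Both facts are pulled back along \<open>Q\<close>.\<close>

lemma AE_RN_deriv_quantile:
  assumes \<mu>: "\<mu> \<in> P0" and ac: "absolutely_continuous Leb \<mu>" and Q: "quantile_of \<mu> Q"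
  shows "AE s in U01. RN_deriv Leb \<mu> (Q s) \<noteq> 0 \<and> RN_deriv Leb \<mu> (Q s) \<noteq> \<infinity>"
proof -
  interpret prob_space Leb by (rule prob_space_Leb)
  interpret M: prob_space \<mu> by (rule P0D[OF \<mu>])
  have "AE x in Leb. RN_deriv Leb \<mu> x \<noteq> \<infinity>"
    by (intro RN_deriv_finite ac sets_Leb \<mu> M.sigma_finite_measure_axioms)
  then have "AE x in density Leb (RN_deriv Leb \<mu>). RN_deriv Leb \<mu> x \<noteq> 0 \<and> RN_deriv Leb \<mu> x \<noteq> \<infinity>"
    by (subst AE_density) auto
  then have "AE x in distr U01 \<mu> Q. RN_deriv Leb \<mu> x \<noteq> 0 \<and> RN_deriv Leb \<mu> x \<noteq> \<infinity>"
    using Q density_RN_deriv_Leb[OF \<mu> ac] by (simp only: quantile_of_def)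
  then show ?thesis
    by (rule AE_distrD[OF quantile_measurable_P0[OF Q \<mu>]])
qed

abbreviation log_density :: "real measure \<Rightarrow> (real \<Rightarrow> real) \<Rightarrow> real \<Rightarrow> real" where
  "log_density \<mu> Q s \<equiv> ln (enn2real (RN_deriv Leb \<mu> (Q s)))"

lemma RN_deriv_quantile_measurable:
  assumes "\<mu> \<in> P0" "quantile_of \<mu> Q"
  shows "(\<lambda>s. RN_deriv Leb \<mu> (Q s)) \<in> borel_measurable U01"
proof -
  have "RN_deriv Leb \<mu> \<in> borel_measurable \<mu>"
    by (simp add: measurable_cong_sets[OF sets_Leb[OF assms(1)] refl])
  with quantile_measurable_P0[OF assms(2,1)] show ?thesis by measurable
qed

text \<open>The density factor is absorbed by passing from \<open>Leb\<close> to \<mu>, which is the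
  law of \<open>Q\<close>. The constant \<open>c\<close> serves to treat the positive part (1) and
  the negative part (-1) together.\<close>

lemma nn_integral_log_density:
  assumes \<mu>: "\<mu> \<in> P0" and ac: "absolutely_continuous Leb \<mu>" and Q: "quantile_of \<mu> Q"
  defines "\<rho> \<equiv> \<lambda>x. enn2real (RN_deriv Leb \<mu> x)"
  shows "(\<integral>\<^sup>+x. ennreal (c * (\<rho> x * ln (\<rho> x))) \<partial>Leb) = (\<integral>\<^sup>+s. ennreal (c * log_density \<mu> Q s) \<partial>U01)"
proof -
  interpret prob_space Leb by (rule prob_space_Leb)
  interpret M: prob_space \<mu> by (rule P0D[OF \<mu>])
  have "RN_deriv Leb \<mu> \<in> borel_measurable \<mu>"
    by (simp add: measurable_cong_sets[OF sets_Leb[OF \<mu>] refl])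
  note [measurable] = this quantile_measurable_P0[OF Q \<mu>]
  have fin: "AE x in Leb. RN_deriv Leb \<mu> x \<noteq> \<infinity>"
    by (intro RN_deriv_finite ac sets_Leb \<mu> M.sigma_finite_measure_axioms)
  have "(\<integral>\<^sup>+s. ennreal (c * log_density \<mu> Q s) \<partial>U01) =
      (\<integral>\<^sup>+x. ennreal (c * ln (\<rho> x)) \<partial>distr U01 \<mu> Q)"
    unfolding \<rho>_def by (subst nn_integral_distr) auto
  also have "\<dots> = (\<integral>\<^sup>+x. ennreal (c * ln (\<rho> x)) \<partial>density Leb (RN_deriv Leb \<mu>))"
    using Q by (simp add: density_RN_deriv_Leb \<mu> ac quantile_of_def)
  also have "\<dots> = (\<integral>\<^sup>+x. RN_deriv Leb \<mu> x * ennreal (c * ln (\<rho> x)) \<partial>Leb)"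
    unfolding \<rho>_def by (subst nn_integral_density) auto
  also have "\<dots> = (\<integral>\<^sup>+x. ennreal (c * (\<rho> x * ln (\<rho> x))) \<partial>Leb)"
  proof (rule nn_integral_cong_AE, use fin in eventually_elim)
    fix x assume "RN_deriv Leb \<mu> x \<noteq> \<infinity>"
    then have eq: "RN_deriv Leb \<mu> x = ennreal (\<rho> x)"
      by (simp add: \<rho>_def less_top)
    then show "RN_deriv Leb \<mu> x * ennreal (c * ln (\<rho> x)) = ennreal (c * (\<rho> x * ln (\<rho> x)))"
      unfolding eq by (subst ennreal_mult'[symmetric]) (simp_all add: \<rho>_def mult_ac)
  qed
  finally show ?thesis ..
qed

lemma Ent_quantile:
  assumes \<mu>: "\<mu> \<in> P0" and ac: "absolutely_continuous Leb \<mu>" and Q: "quantile_of \<mu> Q"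
  shows "Ent \<mu> Leb = enn2ereal (\<integral>\<^sup>+s. ennreal (log_density \<mu> Q s) \<partial>U01) -
           enn2ereal (\<integral>\<^sup>+s. ennreal (- log_density \<mu> Q s) \<partial>U01)"
    and "(\<integral>\<^sup>+s. ennreal (- log_density \<mu> Q s) \<partial>U01) \<noteq> \<infinity>"
proof -
  interpret prob_space Leb by (rule prob_space_Leb)
  note n = nn_integral_log_density[OF assms]
  show "Ent \<mu> Leb = enn2ereal (\<integral>\<^sup>+s. ennreal (log_density \<mu> Q s) \<partial>U01) -
      enn2ereal (\<integral>\<^sup>+s. ennreal (- log_density \<mu> Q s) \<partial>U01)"
    unfolding Ent_def using ac n[of 1] n[of "-1"] by (simp add: Let_def)
  \<comment> \<open>Multiplying \<open>ln (1 / x) \<le> 1 / x - 1\<close> by \<open>x\<close> gives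
    even the bound \<open>1 - x\<close>. As \<open>Leb\<close> has mass 1, the negative part of the
    entropy is at most 1.\<close>
  have "- (x * ln x) \<le> 1" if "0 \<le> x" for x :: real
  proof (cases "x = 0")
    case False
    with that have "- ln x \<le> 1 / x - 1"
      using ln_le_minus_one[of "1 / x"] by (simp add: ln_div)
    with that False have "x * - ln x \<le> x * (1 / x - 1)"
      by (intro mult_left_mono) auto
    with that False show ?thesis by (simp add: algebra_simps)
  qed simp
  then have "(\<integral>\<^sup>+s. ennreal (- log_density \<mu> Q s) \<partial>U01) \<le> (\<integral>\<^sup>+x. ennreal 1 \<partial>Leb)"
    unfolding n[of "-1", simplified, symmetric]
    by (intro nn_integral_mono ennreal_leI) auto
  then show "(\<integral>\<^sup>+s. ennreal (- log_density \<mu> Q s) \<partial>U01) \<noteq> \<infinity>"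
    by (auto simp: emeasure_space_1 top_unique)
qed

lemma Ent_eq_integral:
  assumes \<mu>: "\<mu> \<in> P0" and ac: "absolutely_continuous Leb \<mu>" and Q: "quantile_of \<mu> Q"
    and fin: "(\<integral>\<^sup>+s. ennreal (log_density \<mu> Q s) \<partial>U01) \<noteq> \<infinity>"
  shows "integrable U01 (log_density \<mu> Q)"
    and "Ent \<mu> Leb = ereal (\<integral>s. log_density \<mu> Q s \<partial>U01)"
proof -
  note E = Ent_quantile[OF \<mu> ac Q]
  note [measurable] = RN_deriv_quantile_measurable[OF \<mu> Q]
  show int: "integrable U01 (log_density \<mu> Q)"
    unfolding real_integrable_def using fin E(2) by simp
  have e: "enn2ereal y = ereal (enn2real y)" if "y \<noteq> \<infinity>" for y
    using that by (cases y) (auto simp: enn2ereal_ennreal)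
  show "Ent \<mu> Leb = ereal (\<integral>s. log_density \<mu> Q s \<partial>U01)"
    unfolding E(1) real_lebesgue_integral_def[OF int] e[OF fin] e[OF E(2)] by simp
qed

text \<open>The negative part is always finite, so an infinite positive part would make the entropy
  infinite.\<close>

lemma finite_Ent:
  assumes \<mu>: "\<mu> \<in> P0" and Q: "quantile_of \<mu> Q" and fin: "Ent \<mu> Leb \<noteq> \<infinity>"
  shows "absolutely_continuous Leb \<mu>" "integrable U01 (log_density \<mu> Q)"
    "Ent \<mu> Leb = ereal (\<integral>s. log_density \<mu> Q s \<partial>U01)"
proof -
  show ac: "absolutely_continuous Leb \<mu>"
    using fin by (auto simp: Ent_def split: if_splits)
  note E = Ent_quantile[OF \<mu> ac Q]
  have "(\<integral>\<^sup>+s. ennreal (log_density \<mu> Q s) \<partial>U01) \<noteq> \<infinity>"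
    using fin E by auto
  from Ent_eq_integral[OF \<mu> ac Q this]
  show "integrable U01 (log_density \<mu> Q)" "Ent \<mu> Leb = ereal (\<integral>s. log_density \<mu> Q s \<partial>U01)" .
qed

section \<open>Convexity of the entropy along geodesics\<close>

text \<open>With \<open>w = u / x + v / y\<close>, write \<open>ln z\<close> as
  \<open>ln (z * w) - ln w\<close>. The first term is at most \<open>z * w - 1\<close>, and
  concavity of \<open>ln\<close> at \<open>1 / x\<close> and \<open>1 / y\<close> bounds the
  second.\<close>

lemma ln_le_harmonic:
  fixes x y z :: real
  assumes "0 < x" "0 < y" "0 < z" "0 < u" "0 < v" "u + v = 1"
  shows "ln z \<le> z * (u / x + v / y) - 1 + (u * ln x + v * ln y)"
proof -
  have w: "0 < u / x + v / y" using assms by (simp add: add_pos_pos)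
  have "u * ln (1 / x) + v * ln (1 / y) \<le> ln (u * (1 / x) + v * (1 / y))"
    using concave_onD[OF ln_concave, of v "1 / x" "1 / y"] assms
    by (simp add: eq_diff_eq[symmetric])
  moreover have "ln (z * (u / x + v / y)) \<le> z * (u / x + v / y) - 1"
    using w assms by (intro ln_le_minus_one) simp
  ultimately show ?thesis
    using assms w by (simp add: ln_mult ln_div)
qed

lemma Ent_geodesic_point:
  assumes \<mu>: "\<mu> \<in> P0" and \<nu>: "\<nu> \<in> P0" and \<sigma>: "\<sigma> \<in> P0"
    and uv: "0 < u" "0 < v" "u + v = 1"
    and d: "dW \<mu> \<sigma> = v * dW \<mu> \<nu>" "dW \<sigma> \<nu> = u * dW \<mu> \<nu>"
  shows "Ent \<sigma> Leb \<le> ereal u * Ent \<mu> Leb + ereal v * Ent \<nu> Leb"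
proof (cases "Ent \<mu> Leb = \<infinity> \<or> Ent \<nu> Leb = \<infinity>")
  case True
  then show ?thesis using uv by auto
next
  case False
  obtain Q R T where Q: "quantile_of \<mu> Q" and R: "quantile_of \<nu> R" and T: "quantile_of \<sigma> T"
    using quantile_exists \<mu> \<nu> \<sigma> by metis
  have E\<mu>: "absolutely_continuous Leb \<mu>" "integrable U01 (log_density \<mu> Q)"
      "Ent \<mu> Leb = ereal (\<integral>s. log_density \<mu> Q s \<partial>U01)"
    using finite_Ent[OF \<mu> Q] False by auto
  have E\<nu>: "absolutely_continuous Leb \<nu>" "integrable U01 (log_density \<nu> R)"
      "Ent \<nu> Leb = ereal (\<integral>s. log_density \<nu> R s \<partial>U01)"
    using finite_Ent[OF \<nu> R] False by auto
  interpret U: prob_space U01 by (rule prob_space_U01)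
  interpret S: prob_space \<sigma> by (rule P0D[OF \<sigma>])
  define r where "r s = RN_deriv Leb \<mu> (Q s)" for s
  define p where "p s = RN_deriv Leb \<nu> (R s)" for s
  define w where "w s = ennreal u * inverse (r s) + ennreal v * inverse (p s)" for s
  have [measurable]: "r \<in> borel_measurable U01" "p \<in> borel_measurable U01"
    unfolding r_def p_def
    by (rule RN_deriv_quantile_measurable[OF \<mu> Q], rule RN_deriv_quantile_measurable[OF \<nu> R])
  then have [measurable]: "w \<in> borel_measurable U01"
    unfolding w_def by measurable
  have T_eq: "AE s in U01. T s = u * Q s + v * R s"
    using geodesic_point_quantile[OF \<mu> \<nu> \<sigma> Q R T _ _ uv(3) d] uv by simp
  have rp: "AE s in U01. r s \<noteq> 0 \<and> r s \<noteq> \<infinity> \<and> p s \<noteq> 0 \<and> p s \<noteq> \<infinity>"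
    using AE_RN_deriv_quantile[OF \<mu> E\<mu>(1) Q] AE_RN_deriv_quantile[OF \<nu> E\<nu>(1) R]
    unfolding r_def p_def by eventually_elim auto
  \<comment> \<open>This is \<open>nn_integral_slope_le\<close> with the interpolated quantile
    replaced by \<open>T\<close>, which agrees with it almost everywhere.\<close>
  have slope: "(\<integral>\<^sup>+s. g (T s) * w s \<partial>U01) \<le> (\<integral>\<^sup>+x. g x \<partial>Leb)" if "g \<in> borel_measurable Leb" for g
  proof -
    have "(\<integral>\<^sup>+s. g (T s) * w s \<partial>U01) = (\<integral>\<^sup>+s. g (u * Q s + v * R s) * w s \<partial>U01)"
      by (rule nn_integral_cong_AE, use T_eq in eventually_elim, simp)
    also have "\<dots> \<le> (\<integral>\<^sup>+x. g x \<partial>Leb)"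
      unfolding w_def r_def p_def
      by (intro nn_integral_slope_le[OF \<mu> Q _ _ \<nu> R] density_RN_deriv_Leb \<mu> \<nu> E\<mu>(1) E\<nu>(1) uv that)
        auto
    finally show ?thesis .
  qed
  note Tm = quantile_measurable_P0[OF T \<sigma>]
  \<comment> \<open>For a null set \<open>A\<close>, the slope inequality applied to its indicator
    forces \<open>w\<close> to vanish almost everywhere on the event that \<open>T\<close> lies in
    \<open>A\<close>. But \<open>w\<close> is nonzero almost everywhere, as \<open>r\<close> and
    \<open>p\<close> are finite there.\<close>
  have ac: "absolutely_continuous Leb \<sigma>"
    unfolding absolutely_continuous_def
  proof
    fix A assume A: "A \<in> null_sets Leb"
    then have A': "A \<in> sets \<sigma>" by (auto simp: sets_Leb[OF \<sigma>])
    note [measurable] = measurable_compose[OF Tm borel_measurable_indicator[OF A']]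
    have "(\<integral>\<^sup>+s. indicator A (T s) * w s \<partial>U01) \<le> (\<integral>\<^sup>+x. indicator A x \<partial>Leb)"
      using A by (intro slope) auto
    also have "\<dots> = 0" using A by (simp add: null_setsD1 null_setsD2)
    finally have "(\<integral>\<^sup>+s. indicator A (T s) * w s \<partial>U01) = 0" by simp
    then have "AE s in U01. indicator A (T s) * w s = 0"
      by (subst (asm) nn_integral_0_iff_AE) auto
    with rp have "AE s in U01. T s \<notin> A"
    proof eventually_elim
      case (elim s)
      then have "w s \<noteq> 0" using uv by (simp add: w_def)
      with elim show ?case by (auto simp: indicator_def split: if_splits)
    qed
    then have "AE x in distr U01 \<sigma> T. x \<notin> A"
      using A' sets.sets_into_space[OF A'] by (subst AE_distr_iff[OF Tm]) auto
    then have "AE x in \<sigma>. x \<notin> A" using T by (simp only: quantile_of_def)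
    then show "A \<in> null_sets \<sigma>" using A' by (simp add: AE_iff_null_sets)
  qed
  define t where "t s = RN_deriv Leb \<sigma> (T s)" for s
  have [measurable]: "t \<in> borel_measurable U01"
    unfolding t_def by (rule RN_deriv_quantile_measurable[OF \<sigma> T])
  \<comment> \<open>The slope inequality is used a second time, now for the density of \<sigma>,
    whose integral is 1.\<close>
  have "(\<integral>\<^sup>+s. t s * w s \<partial>U01) \<le> (\<integral>\<^sup>+x. RN_deriv Leb \<sigma> x \<partial>Leb)"
    unfolding t_def by (intro slope) simp
  also have "\<dots> = emeasure (density Leb (RN_deriv Leb \<sigma>)) (space Leb)"
    by (subst emeasure_density) (auto intro!: nn_integral_cong)
  also have "\<dots> = 1"
    using S.emeasure_space_1 sets_eq_imp_space_eq[OF sets_Leb[OF \<sigma>]]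
    by (simp add: density_RN_deriv_Leb \<sigma> ac)
  finally have k1: "(\<integral>\<^sup>+s. t s * w s \<partial>U01) \<le> 1" .
  then have kfin: "AE s in U01. t s * w s \<noteq> \<infinity>"
    by (intro nn_integral_noteq_infinite) (auto simp: top_unique)
  define K where "K s = enn2real (t s * w s)" for s
  have [measurable]: "K \<in> borel_measurable U01" unfolding K_def by measurable
  have K0: "0 \<le> K s" for s by (simp add: K_def)
  have K: "(\<integral>\<^sup>+s. ennreal (K s) \<partial>U01) \<le> 1"
  proof -
    have "(\<integral>\<^sup>+s. ennreal (K s) \<partial>U01) = (\<integral>\<^sup>+s. t s * w s \<partial>U01)"
      by (rule nn_integral_cong_AE, use kfin in eventually_elim, simp add: K_def less_top)
    with k1 show ?thesis by simp
  qed
  have Ki: "integrable U01 K"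
    using K by (intro integrableI_nonneg) (auto simp: K0 intro: le_less_trans)
  have K1: "(\<integral>s. K s \<partial>U01) \<le> 1"
    using K by (subst (asm) nn_integral_eq_integral[OF Ki]) (auto simp: K0)
  \<comment> \<open>\<open>H\<close> is the right-hand side of \<open>ln_le_harmonic\<close> at the
    three densities. Its term \<open>K s - 1\<close> has nonpositive integral by \<open>K1\<close>,
    which leaves the convex combination of the two entropies.\<close>
  define H where "H s = K s - 1 + (u * log_density \<mu> Q s + v * log_density \<nu> R s)" for s
  have Hi: "integrable U01 H"
    unfolding H_def using Ki E\<mu>(2) E\<nu>(2) by simp
  have "(\<integral>s. H s \<partial>U01) = (\<integral>s. K s \<partial>U01) - 1 +
      (u * (\<integral>s. log_density \<mu> Q s \<partial>U01) + v * (\<integral>s. log_density \<nu> R s \<partial>U01))"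
    unfolding H_def using Ki E\<mu>(2) E\<nu>(2) U.prob_space by simp
  with K1 have H1: "(\<integral>s. H s \<partial>U01) \<le>
      u * (\<integral>s. log_density \<mu> Q s \<partial>U01) + v * (\<integral>s. log_density \<nu> R s \<partial>U01)"
    by simp
  have LH: "AE s in U01. log_density \<sigma> T s \<le> H s"
    using rp AE_RN_deriv_quantile[OF \<sigma> ac T]
  proof eventually_elim
    case (elim s)
    define x where "x = enn2real (r s)"
    define y where "y = enn2real (p s)"
    define z where "z = enn2real (t s)"
    have xyz: "r s = ennreal x" "p s = ennreal y" "t s = ennreal z" "0 < x" "0 < y" "0 < z"
      using elim by (auto simp: x_def y_def z_def t_def less_top enn2real_positive_iff zero_less_iff_neq_zero)
    then have "t s * w s = ennreal (z * (u / x + v / y))"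
      using uv by (simp add: w_def inverse_ennreal divide_inverse ennreal_mult ennreal_plus)
    moreover have "0 \<le> z * (u / x + v / y)"
      using xyz uv by (simp add: add_nonneg_nonneg)
    ultimately have "K s = z * (u / x + v / y)" by (simp add: K_def)
    then show ?case
      using ln_le_harmonic[OF xyz(4-6) uv] by (simp add: H_def x_def y_def z_def r_def p_def t_def)
  qed
  \<comment> \<open>The integrable majorant \<open>H\<close> makes the positive part of the entropy
    of \<sigma> finite; only then can that entropy be written as a Bochner integral and
    compared.\<close>
  have "(\<integral>\<^sup>+s. ennreal (log_density \<sigma> T s) \<partial>U01) \<le> (\<integral>\<^sup>+s. ennreal (H s) \<partial>U01)"
    by (rule nn_integral_mono_AE, use LH in eventually_elim, rule ennreal_leI)
  moreover have "(\<integral>\<^sup>+s. ennreal (H s) \<partial>U01) \<noteq> \<infinity>"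
    using Hi by (simp add: real_integrable_def)
  ultimately have "(\<integral>\<^sup>+s. ennreal (log_density \<sigma> T s) \<partial>U01) \<noteq> \<infinity>"
    by (auto simp: top_unique)
  note E\<sigma> = Ent_eq_integral[OF \<sigma> ac T this]
  have "(\<integral>s. log_density \<sigma> T s \<partial>U01) \<le> (\<integral>s. H s \<partial>U01)"
    by (intro integral_mono_AE E\<sigma>(1) Hi LH)
  with H1 show ?thesis
    unfolding E\<sigma>(2) E\<mu>(3) E\<nu>(3) by simp
qed

text \<open>Between two of its times a geodesic again has distances proportional to time
  differences, so \<open>Ent_geodesic_point\<close> applies to the points at times \<open>x\<close>,
  \<open>?z\<close> and \<open>y\<close>.\<close>

lemma geodesic_Ent_convex:
  assumes g: "geodesic_between \<mu>0 \<mu>1 \<mu>"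
  shows "ereal_convex_on {0..1} (\<lambda>t. Ent (\<mu> t) Leb)"
  unfolding ereal_convex_on_def
proof (intro conjI ballI allI impI)
  fix x y u v :: real
  assume xy: "x \<in> {0..1}" "y \<in> {0..1}" and uv: "0 \<le> u" "0 \<le> v" "u + v = 1"
  let ?z = "u *\<^sub>R x + v *\<^sub>R y"
  have z: "?z \<in> {0..1}"
    using xy uv by (intro convexD) auto
  have P: "\<mu> t \<in> P0" and d: "dW (\<mu> t) (\<mu> t') = \<bar>t - t'\<bar> * dW \<mu>0 \<mu>1"
    if "t \<in> {0..1}" "t' \<in> {0..1}" for t t'
    using g that by (auto simp: geodesic_between_def)
  show "Ent (\<mu> ?z) Leb \<le> ereal u * Ent (\<mu> x) Leb + ereal v * Ent (\<mu> y) Leb"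
  \<comment> \<open>With a zero weight \<open>?z\<close> is an end point and the claim is an
    equality, since \<open>0 * \<infinity> = 0\<close> in \<open>ereal\<close>.\<close>
  proof (cases "u = 0 \<or> v = 0")
    case True
    then show ?thesis
      using uv by (auto simp flip: zero_ereal_def one_ereal_def)
  next
    case False
    have u: "u = 1 - v" using uv by simp
    \<comment> \<open>The weights swap: weight \<open>u\<close> at \<open>x\<close> places
      \<open>?z\<close> at the fraction \<open>v\<close> of the way from \<open>x\<close> to
      \<open>y\<close>.\<close>
    have "x - ?z = v * (x - y)" "?z - y = u * (x - y)"
      unfolding u by (simp_all add: algebra_simps)
    then have "\<bar>x - ?z\<bar> = v * \<bar>x - y\<bar>" "\<bar>?z - y\<bar> = u * \<bar>x - y\<bar>"
      using uv by (simp_all only: abs_mult abs_of_nonneg)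
    then show ?thesis
      using False uv xy z by (intro Ent_geodesic_point P) (auto simp: d simp del: scaleR_conv_of_real real_scaleR_def)
  qed
qed simp

theorem corollary6p4:
  shows "(\<forall>\<mu>0\<in>P0. \<forall>\<mu>1\<in>P0. \<forall>\<mu>. geodesic_between \<mu>0 \<mu>1 \<mu> \<longrightarrow>
            ereal_convex_on {0..1} (\<lambda>t::real. Ent (\<mu> t) Leb)) \<and>
         ac_displacement_zero_convex (\<lambda>\<mu>. Ent \<mu> Leb)"
proof
  show "\<forall>\<mu>0\<in>P0. \<forall>\<mu>1\<in>P0. \<forall>\<mu>. geodesic_between \<mu>0 \<mu>1 \<mu> \<longrightarrow>
            ereal_convex_on {0..1} (\<lambda>t::real. Ent (\<mu> t) Leb)"
    using geodesic_Ent_convex by blast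
  show "ac_displacement_zero_convex (\<lambda>\<mu>. Ent \<mu> Leb)"
    unfolding ac_displacement_zero_convex_def
  proof (intro ballI allI impI)
    fix \<mu>0 \<mu>1 :: "real measure" and \<mu> and t :: real
    assume g: "geodesic_between \<mu>0 \<mu>1 \<mu>" and t: "t \<in> {0..1}"
    have "\<forall>x\<in>{0..1}. \<forall>y\<in>{0..1}. \<forall>u\<ge>0. \<forall>v\<ge>0. u + v = 1 \<longrightarrow>
        Ent (\<mu> (u *\<^sub>R x + v *\<^sub>R y)) Leb \<le> ereal u * Ent (\<mu> x) Leb + ereal v * Ent (\<mu> y) Leb"
      using geodesic_Ent_convex[OF g] unfolding ereal_convex_on_def by (rule conjunct2)
    \<comment> \<open>The points 1 and 0 with weights \<open>t\<close> and \<open>1 - t\<close>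
      combine to the time \<open>t\<close>.\<close>
    from this[rule_format, of 1 0 t "1 - t"] t
    have "Ent (\<mu> t) Leb \<le> ereal t * Ent (\<mu> 1) Leb + ereal (1 - t) * Ent (\<mu> 0) Leb"
      by simp
    then show "Ent (\<mu> t) Leb \<le> ereal t * Ent \<mu>1 Leb + ereal (1 - t) * Ent \<mu>0 Leb"
      using g by (simp add: geodesic_between_def)
  qed
qed

end
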